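(* Let $X$ be a (possibly unbounded) subset of $\mathbb{R}^n$ and let $r>0$. Then $\sigma(X)=e_r(X)$ for some distance-decreasing similarity transformation $\sigma$ if and only if $X$ is a convex body with an inscribed ball of radius $>r$.
   Context: Erosion: for $X\subset\mathbb{R}^n$ and $r>0$, $e_r(X)=X\setminus\bigcup_{y\in X^C}B(r,y)$, where $X^C=\mathbb{R}^n\setminus X$ and $B(r,y)$ is the open ball of radius $r$ about $y$. A similarity transformation is a map $\sigma:\mathbb{R}^n\to\mathbb{R}^n$ for which there is a scaling factor $\alpha>0$ with $|\sigma(x)-\sigma(y)|=\alpha|x-y|$ for all $x,y$; it is distance-decreasing if $\alpha<1$. A convex body is a closed convex subset of $\mathbb{R}^n$ (not necessarily bounded). A closed half-space $H$ containing the convex body $X$ is a supporting half-space of $X$ at a boundary point $x$ of $X$ if $x$ also lies on the boundary of $H$. A boundary point $x$ of $X$ is regular if it has a unique supporting half-space. A supporting half-space is regular if it is supporting at at least one regular point of $X$. A (regular) supporting hyperplane is the boundary of a (regular) supporting half-space. A closed ball $B$ is inscribed in the convex body $X$ if $B\subset X$ and $B$ intersects all the regular supporting hyperplanes of $X$.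
   Formalization: X is assumed nonempty (and n ≥ 1): for X = ∅ the claim fails, since σ(∅) = ∅ = e_r(∅) for every similarity σ, while the empty set contains no ball of positive radius. *)

theory Defs
  imports "HOL-Analysis.Analysis"
begin

definition erosion :: "real \<Rightarrow> 'a::metric_space set \<Rightarrow> 'a set" where
  "erosion r X = X - (\<Union>y\<in>-X. ball y r)"

definition similarity :: "real \<Rightarrow> ('a::metric_space \<Rightarrow> 'a) \<Rightarrow> bool" where
  "similarity \<alpha> \<sigma> \<longleftrightarrow> \<alpha> > 0 \<and> (\<forall>x y. dist (\<sigma> x) (\<sigma> y) = \<alpha> * dist x y)"

definition distance_decreasing_similarity :: "('a::metric_space \<Rightarrow> 'a) \<Rightarrow> bool" where
  "distance_decreasing_similarity \<sigma> \<longleftrightarrow> (\<exists>\<alpha>. similarity \<alpha> \<sigma> \<and> \<alpha> < 1)"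

text \<open>Convex bodies need not be bounded, nor have nonempty interior.\<close>

definition convex_body :: "'a::euclidean_space set \<Rightarrow> bool" where
  "convex_body X \<longleftrightarrow> closed X \<and> convex X"

definition closed_halfspace :: "'a::euclidean_space set \<Rightarrow> bool" where
  "closed_halfspace H \<longleftrightarrow> (\<exists>a b. a \<noteq> 0 \<and> H = {x. a \<bullet> x \<le> b})"

definition supporting_halfspace_at :: "'a::euclidean_space set \<Rightarrow> 'a \<Rightarrow> 'a set \<Rightarrow> bool" where
  "supporting_halfspace_at X x H \<longleftrightarrow>
     closed_halfspace H \<and> X \<subseteq> H \<and> x \<in> frontier X \<and> x \<in> frontier H"

definition regular_point :: "'a::euclidean_space set \<Rightarrow> 'a \<Rightarrow> bool" where
  "regular_point X x \<longleftrightarrow> x \<in> frontier X \<and> (\<exists>!H. supporting_halfspace_at X x H)"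

definition regular_supporting_halfspace :: "'a::euclidean_space set \<Rightarrow> 'a set \<Rightarrow> bool" where
  "regular_supporting_halfspace X H \<longleftrightarrow>
     (\<exists>x. regular_point X x \<and> supporting_halfspace_at X x H)"

definition regular_supporting_hyperplane :: "'a::euclidean_space set \<Rightarrow> 'a set \<Rightarrow> bool" where
  "regular_supporting_hyperplane X P \<longleftrightarrow>
     (\<exists>H. regular_supporting_halfspace X H \<and> P = frontier H)"

text \<open>The ball is given by its centre and its (positive) radius. If \<open>X\<close> is the whole space
  there are no supporting hyperplanes, and every ball is inscribed.\<close>

definition inscribed_ball :: "'a::euclidean_space set \<Rightarrow> 'a \<Rightarrow> real \<Rightarrow> bool" where
  "inscribed_ball X c \<rho> \<longleftrightarrow>
     \<rho> > 0 \<and> cball c \<rho> \<subseteq> X \<and>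
     (\<forall>P. regular_supporting_hyperplane X P \<longrightarrow> cball c \<rho> \<inter> P \<noteq> {})"

end

theory Submission
  imports Defs
begin

text \<open>
  A point lies in the erosion of \<open>X\<close> by \<open>r > 0\<close> iff the open ball of radius \<open>r\<close> about it lies in \<open>X\<close>.

  Suppose first that \<open>X\<close> is a convex body with an inscribed ball of centre \<open>c\<close> and radius
  \<open>\<rho> > r\<close>. A closed convex set with interior is the intersection of its regular supporting
  half-spaces, because regular points are dense in the boundary: a maximal ball in \<open>X\<close> about an
  interior point touches the boundary, and at a touching point only one supporting half-space is
  possible. Since the ball lies in \<open>X\<close> and meets all regular supporting hyperplanes, each of them
  is at distance exactly \<open>\<rho>\<close> from \<open>c\<close>. Eroding moves all of them inwards by \<open>r\<close>, so the erosion is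
  the homothetic copy of \<open>X\<close> with centre \<open>c\<close> and ratio \<open>1 - r / \<rho>\<close>
  (\<open>erosion_eq_homothety_if_inscribed_ball\<close>).

  Conversely, let \<open>\<sigma>\<close> have ratio \<open>\<alpha> < 1\<close>, fixed point \<open>c\<close> and orthogonal part \<open>U\<close>, and let
  \<open>\<sigma> ` X\<close> be the erosion of \<open>X\<close> by \<open>r\<close>. As erosions compose by adding their depths, \<open>\<sigma>\<^sup>k\<close> maps
  \<open>X\<close> onto its erosion by \<open>s\<^sub>k = R (1 - \<alpha>\<^sup>k)\<close>, where \<open>R = r / (1 - \<alpha>) > r\<close>. Everything follows
  from letting \<open>k\<close> grow.

  \<^item> The orbit of a point of \<open>X\<close> tends to \<open>c\<close>, and the ball of radius \<open>s\<^sub>k\<close> about its \<open>k\<close>-th point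
    lies in \<open>X\<close>. Hence the closed ball of radius \<open>R\<close> about \<open>c\<close> lies in \<open>X\<close>, which is closed
    because its erosion is.

  \<^item> If \<open>y\<close> is outside \<open>X\<close>, then the ball of radius \<open>s\<^sub>k\<close> about \<open>\<sigma>\<^sup>k y\<close> contains some point \<open>q\<close> outside
    \<open>X\<close>. Pulling back along \<open>\<sigma>\<^sup>k\<close>, the point \<open>y\<close> lies in a ball of radius \<open>s\<^sub>k / \<alpha>\<^sup>k\<close> that misses
    \<open>X\<close>. These balls are arbitrarily large, so they approximate half-spaces, and \<open>X\<close> is convex.

  \<^item> Let \<open>u\<close> be the outer unit normal at a regular point \<open>x\<close>, and let the supporting hyperplane at \<open>x\<close>
    have distance \<open>R + g\<close> from \<open>c\<close>, where \<open>g \<ge> 0\<close> as the ball lies in \<open>X\<close>. The ball of radius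
    \<open>s\<^sub>k\<close> about \<open>\<sigma>\<^sup>k x\<close> touches the boundary of \<open>X\<close>, and uniqueness of the normal at \<open>x\<close> forces
    the touching hyperplane to have normal \<open>U\<^sup>k u\<close>; its distance from \<open>c\<close> is
    \<open>R + \<alpha>\<^sup>k g\<close>. Since \<open>U\<close> is orthogonal, \<open>U\<^sup>k u\<close> comes back arbitrarily close to \<open>u\<close> for large
    \<open>k\<close>, which is incompatible with \<open>g > 0\<close>. So the ball of radius \<open>R\<close> about \<open>c\<close> is inscribed.
\<close>

section \<open>Erosion\<close>

lemma mem_erosion_iff:
  fixes X :: "'a::metric_space set"
  assumes "r > 0"
  shows "x \<in> erosion r X \<longleftrightarrow> ball x r \<subseteq> X"
proof -
  have "x \<in> ball x r"
    using assms by simp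
  then show ?thesis
    unfolding erosion_def by (auto simp: subset_iff dist_commute)
qed

lemma erosion_0 [simp]: "erosion 0 X = X"
  by (simp add: erosion_def)

lemma closed_erosion:
  fixes X :: "'a::metric_space set"
  assumes "r > 0"
  shows "closed (erosion r X)"
proof -
  have "erosion r X = - (\<Union>y\<in>-X. ball y r)"
  proof -
    have "x \<in> X" if "x \<notin> (\<Union>y\<in>-X. ball y r)" for x
      using that assms by (metis Compl_iff UN_I centre_in_ball)
    then show ?thesis
      by (auto simp: erosion_def)
  qed
  moreover have "closed (- (\<Union>y\<in>-X. ball y r))"
    by (intro closed_Compl open_UN ballI open_ball)
  ultimately show ?thesis
    by simp
qed

text \<open>
  The ball of radius \<open>s + t\<close> is the Minkowski sum of those of radius \<open>s\<close> and \<open>t\<close>. This needs a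
  linear structure: a point of the large ball is reached by splitting the segment from the centre
  in the ratio \<open>s\<close> to \<open>t\<close>.
\<close>

lemma ball_subset_iff_balls_subset:
  fixes X :: "'a::real_normed_vector set"
  assumes "s > 0" "t > 0"
  shows "ball x (s + t) \<subseteq> X \<longleftrightarrow> (\<forall>y\<in>ball x s. ball y t \<subseteq> X)"
proof
  assume "ball x (s + t) \<subseteq> X"
  moreover have "ball y t \<subseteq> ball x (s + t)" if "y \<in> ball x s" for y
  proof
    fix z assume "z \<in> ball y t"
    with that dist_triangle[of x z y] show "z \<in> ball x (s + t)"
      by simp
  qed
  ultimately show "\<forall>y\<in>ball x s. ball y t \<subseteq> X"
    by blast
next
  assume R: "\<forall>y\<in>ball x s. ball y t \<subseteq> X"
  show "ball x (s + t) \<subseteq> X"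
  proof
    fix z assume z: "z \<in> ball x (s + t)"
    define y where "y = x + (s / (s + t)) *\<^sub>R (z - x)"
    have d: "norm (z - x) < s + t"
      using z by (simp add: dist_norm norm_minus_commute)
    have "dist x y = (s / (s + t)) * norm (z - x)"
      using assms by (simp add: y_def dist_norm)
    also have "\<dots> < (s / (s + t)) * (s + t)"
      using d assms by (intro mult_strict_left_mono) auto
    also have "\<dots> = s"
      using assms by simp
    finally have 1: "y \<in> ball x s"
      by simp
    have "z - y = (t / (s + t)) *\<^sub>R (z - x)"
    proof -
      have "t / (s + t) = 1 - s / (s + t)"
        using assms by (simp add: field_simps)
      then show ?thesis
        by (simp add: y_def scaleR_diff_left)
    qed
    then have "norm (z - y) = (t / (s + t)) * norm (z - x)"
      using assms by simp
    then have "dist y z = (t / (s + t)) * norm (z - x)"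
      by (simp only: dist_norm norm_minus_commute)
    also have "\<dots> < (t / (s + t)) * (s + t)"
      using d assms by (intro mult_strict_left_mono) auto
    also have "\<dots> = t"
      using assms by simp
    finally have "z \<in> ball y t"
      by simp
    with R 1 show "z \<in> X"
      by blast
  qed
qed

lemma erosion_erosion:
  fixes X :: "'a::real_normed_vector set"
  assumes "s \<ge> 0" "t \<ge> 0"
  shows "erosion s (erosion t X) = erosion (s + t) X"
proof (cases "s = 0 \<or> t = 0")
  case True
  then show ?thesis by auto
next
  case False
  then have "s > 0" "t > 0"
    using assms by auto
  then show ?thesis
    using ball_subset_iff_balls_subset[of s t _ X]
    by (auto simp: set_eq_iff mem_erosion_iff subset_iff[where B = "erosion t X"])
qed

lemma erosion_similarity_image:
  fixes X :: "'a::metric_space set"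
  assumes "similarity \<alpha> \<sigma>" "surj \<sigma>"
  shows "erosion (\<alpha> * s) (\<sigma> ` X) = \<sigma> ` erosion s X"
proof -
  have \<alpha>: "\<alpha> > 0" and d: "dist (\<sigma> x) (\<sigma> y) = \<alpha> * dist x y" for x y
    using assms(1) by (auto simp: similarity_def)
  have "inj \<sigma>"
    by (rule injI) (metis \<alpha> d dist_eq_0_iff mult_eq_0_iff less_irrefl)
  then have "bij \<sigma>"
    using assms(2) by (simp add: bij_def)
  have b: "ball (\<sigma> y) (\<alpha> * s) = \<sigma> ` ball y s" for y
  proof -
    have "\<sigma> x \<in> ball (\<sigma> y) (\<alpha> * s) \<longleftrightarrow> x \<in> ball y s" for x
      using \<alpha> by (simp add: d)
    then have "ball y s = \<sigma> -` ball (\<sigma> y) (\<alpha> * s)"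
      by blast
    then show ?thesis
      using assms(2) by (simp add: surj_image_vimage_eq)
  qed
  have c: "- \<sigma> ` X = \<sigma> ` (- X)"
    using \<open>bij \<sigma>\<close> by (simp add: bij_image_Compl_eq)
  have "(\<Union>y\<in>- \<sigma> ` X. ball y (\<alpha> * s)) = \<sigma> ` (\<Union>y\<in>-X. ball y s)"
    unfolding c by (simp add: image_UN b)
  then show ?thesis
    unfolding erosion_def by (simp add: image_set_diff[OF \<open>inj \<sigma>\<close>])
qed

section \<open>Outer unit normals\<close>

lemma cball_subset_if_ball_subset:
  fixes X :: "'a::real_normed_vector set"
  assumes "closed X" "ball x d \<subseteq> X" "d > 0"
  shows "cball x d \<subseteq> X"
  using closure_minimal[OF assms(2,1)] assms(3) by simp

lemma centre_in_interior:
  fixes X :: "'a::metric_space set"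
  assumes "cball x d \<subseteq> X" "d > 0"
  shows "x \<in> interior X"
  using assms unfolding mem_interior by (meson ball_subset_cball subset_trans)

text \<open>
  Supporting half-spaces correspond one-to-one to unit normals. The normals are what the proofs
  compute with, so regularity and inscribed balls are rephrased through them.
\<close>

definition outer_normal :: "'a::euclidean_space set \<Rightarrow> 'a \<Rightarrow> 'a \<Rightarrow> bool" where
  "outer_normal X x u \<longleftrightarrow> x \<in> frontier X \<and> norm u = 1 \<and> (\<forall>w\<in>X. u \<bullet> w \<le> u \<bullet> x)"

lemma supporting_halfspace_at_iff_outer_normal:
  "supporting_halfspace_at X x H \<longleftrightarrow> (\<exists>u. outer_normal X x u \<and> H = {w. u \<bullet> w \<le> u \<bullet> x})"
proof
  assume H: "supporting_halfspace_at X x H"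
  then obtain a b where ab: "a \<noteq> 0" "H = {w. a \<bullet> w \<le> b}"
    by (auto simp: supporting_halfspace_at_def closed_halfspace_def)
  then have b: "a \<bullet> x = b"
    using H by (simp add: supporting_halfspace_at_def frontier_halfspace_le)
  have sgn: "sgn a \<bullet> w \<le> sgn a \<bullet> x \<longleftrightarrow> a \<bullet> w \<le> a \<bullet> x" for w
    using ab(1) by (simp add: sgn_div_norm divide_right_mono field_simps)
  have "outer_normal X x (sgn a)"
    using H ab b by (auto simp: outer_normal_def supporting_halfspace_at_def norm_sgn sgn)
  moreover have "H = {w. sgn a \<bullet> w \<le> sgn a \<bullet> x}"
    using ab b by (simp add: sgn)
  ultimately show "\<exists>u. outer_normal X x u \<and> H = {w. u \<bullet> w \<le> u \<bullet> x}"
    by blast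
next
  assume "\<exists>u. outer_normal X x u \<and> H = {w. u \<bullet> w \<le> u \<bullet> x}"
  then obtain u where u: "outer_normal X x u" "H = {w. u \<bullet> w \<le> u \<bullet> x}"
    by blast
  then have "u \<noteq> 0"
    by (auto simp: outer_normal_def)
  then show "supporting_halfspace_at X x H"
    using u by (auto simp: supporting_halfspace_at_def closed_halfspace_def outer_normal_def
        frontier_halfspace_le)
qed

text \<open>
  Testing the half-spaces on the single point \<open>x + (u - v)\<close> suffices: both normals must have
  non-positive inner product with \<open>u - v\<close>, and this yields \<open>u \<bullet> v \<ge> 1\<close>.
\<close>

lemma unit_normal_of_halfspace_unique:
  fixes u v :: "'a::euclidean_space"
  assumes "norm u = 1" "norm v = 1" "{w. u \<bullet> w \<le> u \<bullet> x} = {w. v \<bullet> w \<le> v \<bullet> x}"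
  shows "u = v"
proof -
  have 1: "u \<bullet> u = 1" "v \<bullet> v = 1"
    using assms by (simp_all add: norm_eq_1)
  have "v \<bullet> (x + (u - v)) \<le> v \<bullet> x"
    using 1 norm_cauchy_schwarz[of v u] assms by (simp add: inner_simps)
  then have "u \<bullet> (x + (u - v)) \<le> u \<bullet> x"
    using assms(3) by blast
  then have "(u - v) \<bullet> (u - v) \<le> 0"
    using 1 by (simp add: inner_simps inner_commute)
  then have "(u - v) \<bullet> (u - v) = 0"
    by (intro antisym inner_ge_zero)
  then show ?thesis
    by simp
qed

lemma regular_point_iff_outer_normal:
  "regular_point X x \<longleftrightarrow> (\<exists>!u. outer_normal X x u)"
proof -
  have "(\<exists>!H. supporting_halfspace_at X x H) \<longleftrightarrow> (\<exists>!u. outer_normal X x u)"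
  proof
    assume "\<exists>!H. supporting_halfspace_at X x H"
    then obtain u where u: "outer_normal X x u"
      and unique: "\<And>H. supporting_halfspace_at X x H \<Longrightarrow> H = {w. u \<bullet> w \<le> u \<bullet> x}"
      unfolding supporting_halfspace_at_iff_outer_normal by auto
    have "v = u" if v: "outer_normal X x v" for v
    proof (rule unit_normal_of_halfspace_unique)
      show "{w. v \<bullet> w \<le> v \<bullet> x} = {w. u \<bullet> w \<le> u \<bullet> x}"
        using v by (intro unique) (auto simp: supporting_halfspace_at_iff_outer_normal)
    qed (use u v in \<open>auto simp: outer_normal_def\<close>)
    with u show "\<exists>!u. outer_normal X x u"
      by blast
  next
    assume "\<exists>!u. outer_normal X x u"
    then show "\<exists>!H. supporting_halfspace_at X x H"
      unfolding supporting_halfspace_at_iff_outer_normal by auto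
  qed
  then show ?thesis
    by (auto simp: regular_point_def outer_normal_def)
qed

lemma regular_supporting_hyperplane_iff_outer_normal:
  "regular_supporting_hyperplane X P \<longleftrightarrow>
     (\<exists>x u. regular_point X x \<and> outer_normal X x u \<and> P = {w. u \<bullet> w = u \<bullet> x})"
proof -
  have "frontier {w. u \<bullet> w \<le> u \<bullet> x} = {w. u \<bullet> w = u \<bullet> x}" if "outer_normal X x u" for x u
    using that by (intro frontier_halfspace_le) (auto simp: outer_normal_def)
  then show ?thesis
    unfolding regular_supporting_hyperplane_def regular_supporting_halfspace_def
      supporting_halfspace_at_iff_outer_normal
    by metis
qed

text \<open>
  The extreme point \<open>c + \<rho> *\<^sub>R u\<close> of the ball decides.
\<close>

lemma cball_in_halfspace_bound:
  fixes u :: "'a::euclidean_space"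
  assumes "norm u = 1" "\<forall>w\<in>X. u \<bullet> w \<le> h" "cball c \<rho> \<subseteq> X" "\<rho> \<ge> 0"
  shows "u \<bullet> c + \<rho> \<le> h"
proof -
  have "c + \<rho> *\<^sub>R u \<in> X"
    using assms by (auto simp: subset_iff dist_norm)
  then have "u \<bullet> (c + \<rho> *\<^sub>R u) \<le> h"
    using assms by blast
  then show ?thesis
    using assms by (simp add: inner_simps dot_square_norm)
qed

text \<open>
  A hyperplane that bounds a half-space containing the ball meets the ball exactly when it is
  tangent to it, that is, at distance \<open>\<rho>\<close> from \<open>c\<close>.
\<close>

lemma inscribed_ball_iff_outer_normal:
  "inscribed_ball X c \<rho> \<longleftrightarrow>
     \<rho> > 0 \<and> cball c \<rho> \<subseteq> X \<and>
     (\<forall>x u. regular_point X x \<longrightarrow> outer_normal X x u \<longrightarrow> u \<bullet> x = u \<bullet> c + \<rho>)"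
proof -
  have "cball c \<rho> \<inter> {w. u \<bullet> w = u \<bullet> x} \<noteq> {} \<longleftrightarrow> u \<bullet> x = u \<bullet> c + \<rho>"
    if "\<rho> > 0" "cball c \<rho> \<subseteq> X" "outer_normal X x u" for x u
  proof
    assume "cball c \<rho> \<inter> {w. u \<bullet> w = u \<bullet> x} \<noteq> {}"
    then obtain w where w: "norm (w - c) \<le> \<rho>" "u \<bullet> w = u \<bullet> x"
      by (auto simp: dist_norm norm_minus_commute)
    have "u \<bullet> (w - c) \<le> norm (w - c)"
      using norm_cauchy_schwarz[of u "w - c"] that by (simp add: outer_normal_def)
    then have "u \<bullet> x \<le> u \<bullet> c + \<rho>"
      using w by (simp add: inner_simps)
    moreover have "u \<bullet> c + \<rho> \<le> u \<bullet> x"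
      using that by (intro cball_in_halfspace_bound[of u X]) (auto simp: outer_normal_def)
    ultimately show "u \<bullet> x = u \<bullet> c + \<rho>"
      by simp
  next
    assume "u \<bullet> x = u \<bullet> c + \<rho>"
    then have "c + \<rho> *\<^sub>R u \<in> cball c \<rho> \<inter> {w. u \<bullet> w = u \<bullet> x}"
      using that by (simp add: outer_normal_def dist_norm inner_simps dot_square_norm)
    then show "cball c \<rho> \<inter> {w. u \<bullet> w = u \<bullet> x} \<noteq> {}"
      by blast
  qed
  then show ?thesis
    unfolding inscribed_ball_def regular_supporting_hyperplane_iff_outer_normal by blast
qed

section \<open>Regular points\<close>

lemma ex_outer_normal:
  fixes X :: "'a::euclidean_space set"
  assumes "convex X" "closed X" "interior X \<noteq> {}" "x \<in> frontier X"
  obtains u where "outer_normal X x u"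
proof -
  have "x \<in> X" "x \<notin> rel_interior X"
    using assms by (auto simp: frontier_def rel_interior_nonempty_interior)
  then obtain a where a: "a \<noteq> 0" "\<And>y. y \<in> X \<Longrightarrow> a \<bullet> x \<le> a \<bullet> y"
    using supporting_hyperplane_rel_boundary[of X x] assms by metis
  have "outer_normal X x (- sgn a)"
    using a assms(4) by (simp add: outer_normal_def norm_sgn sgn_div_norm divide_right_mono)
  then show thesis
    by (rule that)
qed

text \<open>
  A half-space that contains a ball and has one of its boundary points on its own boundary is
  tangent there, so its normal points along the radius. In Cauchy--Schwarz for \<open>u\<close> and \<open>x - q\<close>
  equality holds.
\<close>

lemma touching_ball_outer_normal:
  fixes X :: "'a::euclidean_space set"
  assumes "cball q d \<subseteq> X" "d > 0" "dist q x = d" "outer_normal X x u"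
  shows "x - q = d *\<^sub>R u"
proof -
  have u: "norm u = 1" and n: "norm (x - q) = d"
    using assms by (auto simp: outer_normal_def dist_norm norm_minus_commute)
  have "u \<bullet> q + d \<le> u \<bullet> x"
    using assms by (intro cball_in_halfspace_bound[of u X]) (auto simp: outer_normal_def)
  moreover have "u \<bullet> (x - q) \<le> d"
    using norm_cauchy_schwarz[of u "x - q"] u n by simp
  ultimately have "u \<bullet> (x - q) = norm u * norm (x - q)"
    using u n by (simp add: inner_simps)
  then show ?thesis
    using u n unfolding norm_cauchy_schwarz_eq by simp
qed

lemma regular_point_if_touching_ball:
  fixes X :: "'a::euclidean_space set"
  assumes "convex X" "closed X" "cball q d \<subseteq> X" "d > 0" "dist q x = d" "x \<in> frontier X"
  shows "regular_point X x"
proof -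
  have "q \<in> interior X"
    using assms by (intro centre_in_interior)
  then obtain u where u: "outer_normal X x u"
    using ex_outer_normal[of X x] assms by blast
  moreover have "v = u" if "outer_normal X x v" for v
    using touching_ball_outer_normal[OF assms(3-5) u] touching_ball_outer_normal[OF assms(3-5) that]
      assms(4) by simp
  ultimately show ?thesis
    unfolding regular_point_iff_outer_normal by blast
qed

text \<open>
  Move from \<open>z\<close> slightly towards the interior point \<open>c\<close>, to \<open>q\<close>. The boundary point \<open>x\<close> nearest to
  \<open>q\<close> is touched by a ball in \<open>X\<close>, and it is at most twice as far from \<open>z\<close> as \<open>q\<close> is.
\<close>

lemma regular_points_dense:
  fixes X :: "'a::euclidean_space set"
  assumes "convex X" "closed X" "c \<in> interior X" "z \<in> frontier X" "\<delta> > 0"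
  obtains x where "regular_point X x" "dist x z < \<delta>"
proof -
  define e where "e = min 1 (\<delta> / (3 * (norm (z - c) + 1)))"
  define q where "q = z - e *\<^sub>R (z - c)"
  have pos: "norm (z - c) + 1 > 0"
    by (smt (verit) norm_ge_zero)
  have e: "0 < e" "e \<le> 1" "e \<le> \<delta> / (3 * (norm (z - c) + 1))"
    using assms(5) pos by (auto simp: e_def)
  have z: "z \<in> closure X"
    using assms(4) by (simp add: frontier_def)
  have q: "q \<in> interior X"
    using mem_interior_closure_convex_shrink[OF assms(1,3) z e(1,2)] by (simp add: q_def)
  have "dist q z = e * norm (z - c)"
    using e(1) by (simp add: q_def dist_norm)
  also have "\<dots> \<le> e * (norm (z - c) + 1)"
    using e(1) by simp
  also have "\<dots> \<le> \<delta> / 3"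
    using e(3) pos by (simp add: field_simps)
  finally have qz: "dist q z \<le> \<delta> / 3" .
  have "closed (frontier X)" "frontier X \<noteq> {}"
    using assms(4) by auto
  then obtain x where x: "x \<in> frontier X" "\<And>y. y \<in> frontier X \<Longrightarrow> dist q x \<le> dist q y"
    by (rule distance_attains_inf[of _ q]) blast
  have d: "dist q x > 0"
    using q x(1) by (auto simp: frontier_def)
  have "ball q (dist q x) \<inter> frontier X = {}"
    using x(2) by force
  moreover have "ball q (dist q x) \<inter> X \<noteq> {}"
    using q d interior_subset by (metis IntI centre_in_ball empty_iff subsetD)
  ultimately have "ball q (dist q x) \<subseteq> X"
    using connected_Int_frontier[OF connected_ball, of q "dist q x" X] by blast
  then have "cball q (dist q x) \<subseteq> X"
    using assms(2) d by (intro cball_subset_if_ball_subset)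
  then have "regular_point X x"
    using regular_point_if_touching_ball[OF assms(1,2)] d x(1) by blast
  moreover have "dist x z < \<delta>"
    using x(2)[OF assms(4)] qz assms(5) dist_triangle[of x z q] by (simp add: dist_commute)
  ultimately show thesis
    by (rule that)
qed

text \<open>
  The segment from \<open>c\<close> to \<open>y\<close> leaves \<open>X\<close> at a boundary point \<open>z\<close>, a proportion \<open>t < 1\<close> of the way.
  The supporting hyperplane at a regular point close to \<open>z\<close> almost contains \<open>z\<close> and stays at distance
  at least \<open>\<rho>\<close> from \<open>c\<close>, so the segment must cross it before reaching \<open>y\<close>. How close the regular
  point has to be depends only on \<open>t\<close> and \<open>\<rho>\<close>.
\<close>

lemma regular_halfspace_separates:
  fixes X :: "'a::euclidean_space set"
  assumes "convex X" "closed X" "cball c \<rho> \<subseteq> X" "\<rho> > 0" "y \<notin> X"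
  obtains x u where "regular_point X x" "outer_normal X x u" "u \<bullet> x < u \<bullet> y"
proof -
  have c: "c \<in> interior X"
    using assms by (intro centre_in_interior)
  then have "closed_segment c y \<inter> frontier X \<noteq> {}"
    using assms interior_subset by (intro connected_Int_frontier) auto
  then obtain t where t: "0 \<le> t" "t \<le> 1" and z: "c + t *\<^sub>R (y - c) \<in> frontier X"
    by (auto simp: closed_segment_image_interval algebra_simps)
  have "t \<noteq> 1"
    using z assms(2,5) by (auto simp: frontier_def)
  with t have t1: "t < 1"
    by simp
  define z where "z = c + t *\<^sub>R (y - c)"
  obtain x where x: "regular_point X x" and xz: "dist x z < (1 - t) * \<rho>"
    using regular_points_dense[OF assms(1,2) c, of z "(1 - t) * \<rho>"] z t1 assms(4)
    by (auto simp: z_def)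
  then obtain u where u: "outer_normal X x u"
    by (auto simp: regular_point_iff_outer_normal)
  have low: "u \<bullet> c + \<rho> \<le> u \<bullet> x"
    using assms u by (intro cball_in_halfspace_bound[of u X]) (auto simp: outer_normal_def)
  have "u \<bullet> (x - z) \<le> dist x z"
    using norm_cauchy_schwarz[of u "x - z"] u by (simp add: outer_normal_def dist_norm)
  then have "u \<bullet> (x - c) - (1 - t) * \<rho> < t * (u \<bullet> (y - c))"
    using xz by (simp add: z_def inner_simps)
  moreover have "(1 - t) * \<rho> \<le> (1 - t) * (u \<bullet> (x - c))"
    using low t1 by (intro mult_left_mono) (auto simp: inner_simps)
  ultimately have "t * (u \<bullet> (x - c)) < t * (u \<bullet> (y - c))"
    by (simp add: algebra_simps)
  then have "u \<bullet> (x - c) < u \<bullet> (y - c)"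
    using t(1) by (simp add: mult_less_cancel_left)
  then have "u \<bullet> x < u \<bullet> y"
    by (simp add: inner_simps)
  with x u show thesis
    by (rule that)
qed

section \<open>Bodies with an inscribed ball\<close>

text \<open>
  A convex body is the intersection of its regular supporting half-spaces, and those of a body
  with an inscribed ball are all tangent to that ball.
\<close>

lemma mem_iff_inscribed_ball:
  assumes "convex_body X" "inscribed_ball X c \<rho>"
  shows "w \<in> X \<longleftrightarrow> (\<forall>x u. regular_point X x \<longrightarrow> outer_normal X x u \<longrightarrow> u \<bullet> w \<le> u \<bullet> c + \<rho>)"
proof -
  have X: "convex X" "closed X" "cball c \<rho> \<subseteq> X" "\<rho> > 0"
    and support_value: "\<And>x u. regular_point X x \<Longrightarrow> outer_normal X x u \<Longrightarrow> u \<bullet> x = u \<bullet> c + \<rho>"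
    using assms unfolding convex_body_def inscribed_ball_iff_outer_normal by auto
  show ?thesis
  proof (intro iffI allI impI)
    fix x u assume "w \<in> X" "regular_point X x" "outer_normal X x u"
    then show "u \<bullet> w \<le> u \<bullet> c + \<rho>"
      using support_value[of x u] by (auto simp: outer_normal_def)
  next
    assume le: "\<forall>x u. regular_point X x \<longrightarrow> outer_normal X x u \<longrightarrow> u \<bullet> w \<le> u \<bullet> c + \<rho>"
    show "w \<in> X"
    proof (rule ccontr)
      assume "w \<notin> X"
      then obtain x u where "regular_point X x" "outer_normal X x u" "u \<bullet> x < u \<bullet> w"
        by (rule regular_halfspace_separates[OF X])
      then show False
        using le support_value[of x u] by fastforce
    qed
  qed
qed

lemma ball_subset_halfspace_iff:
  fixes u :: "'a::euclidean_space"
  assumes "norm u = 1" "r > 0"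
  shows "ball x r \<subseteq> {w. u \<bullet> w \<le> h} \<longleftrightarrow> u \<bullet> x + r \<le> h"
proof
  assume "ball x r \<subseteq> {w. u \<bullet> w \<le> h}"
  then have "cball x r \<subseteq> {w. u \<bullet> w \<le> h}"
    using assms(2) by (intro cball_subset_if_ball_subset closed_halfspace_le)
  then show "u \<bullet> x + r \<le> h"
    using assms by (intro cball_in_halfspace_bound[of u "{w. u \<bullet> w \<le> h}"]) auto
next
  assume h: "u \<bullet> x + r \<le> h"
  show "ball x r \<subseteq> {w. u \<bullet> w \<le> h}"
  proof
    fix w assume "w \<in> ball x r"
    then have "u \<bullet> (w - x) \<le> r"
      using norm_cauchy_schwarz[of u "w - x"] assms by (simp add: dist_norm norm_minus_commute)
    then show "w \<in> {w. u \<bullet> w \<le> h}"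
      using h by (simp add: inner_simps)
  qed
qed

text \<open>
  Erosion commutes with intersections and shifts every half-space inwards by \<open>r\<close>, while the
  homothety scales its distance \<open>\<rho>\<close> from \<open>c\<close>. Both turn \<open>\<rho>\<close> into \<open>\<rho> - r\<close>, and it matters that this
  distance is the same for all the half-spaces.
\<close>

lemma erosion_eq_homothety_if_inscribed_ball:
  fixes X :: "'a::euclidean_space set"
  assumes "convex_body X" "inscribed_ball X c \<rho>" "0 < r" "r < \<rho>"
  shows "(\<lambda>x. c + (1 - r / \<rho>) *\<^sub>R (x - c)) ` X = erosion r X"
proof -
  define \<alpha> where "\<alpha> = 1 - r / \<rho>"
  have \<alpha>: "\<alpha> > 0" and \<alpha>\<rho>: "\<alpha> * \<rho> = \<rho> - r"
    using assms by (auto simp: \<alpha>_def field_simps)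
  define N where "N = {u. \<exists>x. regular_point X x \<and> outer_normal X x u}"
  have N: "norm u = 1" if "u \<in> N" for u
    using that by (auto simp: N_def outer_normal_def)
  have X: "X = (\<Inter>u\<in>N. {w. u \<bullet> w \<le> u \<bullet> c + \<rho>})"
    using mem_iff_inscribed_ball[OF assms(1,2)] by (auto simp: N_def)
  have "c + \<alpha> *\<^sub>R (x - c) \<in> erosion r X \<longleftrightarrow> x \<in> X" for x
  proof -
    have "c + \<alpha> *\<^sub>R (x - c) \<in> erosion r X \<longleftrightarrow>
        (\<forall>u\<in>N. ball (c + \<alpha> *\<^sub>R (x - c)) r \<subseteq> {w. u \<bullet> w \<le> u \<bullet> c + \<rho>})"
      unfolding mem_erosion_iff[OF assms(3)] by (subst X) (simp add: le_INF_iff)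
    also have "\<dots> \<longleftrightarrow> (\<forall>u\<in>N. u \<bullet> x \<le> u \<bullet> c + \<rho>)"
    proof (intro ball_cong refl)
      fix u assume "u \<in> N"
      have "u \<bullet> (c + \<alpha> *\<^sub>R (x - c)) + r \<le> u \<bullet> c + \<rho> \<longleftrightarrow> \<alpha> * (u \<bullet> (x - c)) \<le> \<alpha> * \<rho>"
        unfolding \<alpha>\<rho> by (simp add: inner_simps) linarith
      also have "\<dots> \<longleftrightarrow> u \<bullet> x \<le> u \<bullet> c + \<rho>"
        using \<alpha> by (simp add: inner_simps) linarith
      finally show "(ball (c + \<alpha> *\<^sub>R (x - c)) r \<subseteq> {w. u \<bullet> w \<le> u \<bullet> c + \<rho>}) \<longleftrightarrow> u \<bullet> x \<le> u \<bullet> c + \<rho>"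
        using ball_subset_halfspace_iff[OF N[OF \<open>u \<in> N\<close>] assms(3)] by simp
    qed
    also have "\<dots> \<longleftrightarrow> x \<in> X"
      by (subst X) simp
    finally show ?thesis .
  qed
  moreover have "y = c + \<alpha> *\<^sub>R ((c + (1 / \<alpha>) *\<^sub>R (y - c)) - c)" for y
    using \<alpha> by simp
  ultimately have "(\<lambda>x. c + \<alpha> *\<^sub>R (x - c)) ` X = erosion r X"
    unfolding set_eq_iff image_iff by metis
  then show ?thesis
    by (simp add: \<alpha>_def)
qed

section \<open>Contracting similarities and recurrence\<close>

text \<open>
  The centre \<open>c\<close> is the fixed point given by Banach's theorem. Rescaling \<open>\<sigma>\<close> about it gives an
  isometry fixing the origin, and such an isometry is linear.
\<close>

lemma contracting_similarity_decompose:
  fixes \<sigma> :: "'a::euclidean_space \<Rightarrow> 'a"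
  assumes "similarity \<alpha> \<sigma>" "\<alpha> < 1"
  obtains c U where "orthogonal_transformation U" "\<sigma> = (\<lambda>x. c + \<alpha> *\<^sub>R U (x - c))"
proof -
  have \<alpha>: "\<alpha> > 0" and d: "dist (\<sigma> x) (\<sigma> y) = \<alpha> * dist x y" for x y
    using assms(1) by (auto simp: similarity_def)
  have "\<exists>!x. \<sigma> x = x"
    using banach_fix_type[of \<alpha> \<sigma>] \<alpha> assms(2) d by simp
  then obtain c where c: "\<sigma> c = c"
    by blast
  define U where "U v = (1 / \<alpha>) *\<^sub>R (\<sigma> (c + v) - c)" for v
  have "dist (U v) (U w) = dist v w" for v w
  proof -
    have "dist (U v) (U w) = (1 / \<alpha>) * dist (\<sigma> (c + v)) (\<sigma> (c + w))"
      using \<alpha> by (simp add: U_def dist_norm flip: scaleR_diff_right)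
    then show ?thesis
      using \<alpha> by (simp add: d)
  qed
  then have "orthogonal_transformation U"
    by (simp add: orthogonal_transformation_isometry U_def c)
  moreover have "\<sigma> = (\<lambda>x. c + \<alpha> *\<^sub>R U (x - c))"
    using \<alpha> by (simp add: U_def)
  ultimately show thesis
    by (rule that)
qed

lemma orthogonal_transformation_funpow:
  fixes U :: "'a::real_inner \<Rightarrow> 'a"
  assumes "orthogonal_transformation U"
  shows "orthogonal_transformation (U ^^ k)"
proof (induction k)
  case 0
  then show ?case
    by (auto simp: orthogonal_transformation linear_iff)
next
  case (Suc k)
  then show ?case
    using orthogonal_transformation_compose[OF assms, of "U ^^ k"] by (simp only: funpow.simps)
qed

text \<open>
  The orbit of \<open>u\<close> stays in a compact ball, so two of its members, far apart in time, are close
  together. Because \<open>U\<close> preserves distances, the earlier time can be shifted to \<open>0\<close>.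
\<close>

lemma orthogonal_transformation_recurrent:
  fixes U :: "'a::euclidean_space \<Rightarrow> 'a"
  assumes "orthogonal_transformation U" "\<epsilon> > 0"
  obtains k where "k \<ge> N" "dist ((U ^^ k) u) u < \<epsilon>"
proof -
  note O = orthogonal_transformation_funpow[OF assms(1)]
  have "compact (cball (0::'a) (norm u))" "\<forall>k. (U ^^ k) u \<in> cball 0 (norm u)"
    using orthogonal_transformation_norm[OF O] by auto
  then obtain l f where f: "strict_mono f" "((\<lambda>k. (U ^^ k) u) \<circ> f) \<longlonglongrightarrow> l"
    using compact_def by metis
  then have "Cauchy ((\<lambda>k. (U ^^ k) u) \<circ> f)"
    using LIMSEQ_imp_Cauchy by blast
  then obtain M where M: "\<And>m n. m \<ge> M \<Longrightarrow> n \<ge> M \<Longrightarrow> dist ((U ^^ f m) u) ((U ^^ f n) u) < \<epsilon>"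
    using assms(2) by (force simp: Cauchy_def)
  have gap: "f M + N \<le> f (M + N)"
    using f(1) by (induction N) (auto simp: strict_mono_Suc_iff Suc_le_eq intro: le_less_trans)
  define k where "k = f (M + N) - f M"
  have k: "k \<ge> N" "f (M + N) = f M + k"
    using gap by (auto simp: k_def)
  have "dist ((U ^^ k) u) u = dist ((U ^^ f M) ((U ^^ k) u)) ((U ^^ f M) u)"
    using O[of "f M"] by (simp add: orthogonal_transformation_isometry)
  also have "\<dots> = dist ((U ^^ f (M + N)) u) ((U ^^ f M) u)"
    by (simp add: k(2) funpow_add)
  also have "\<dots> < \<epsilon>"
    by (rule M) auto
  finally show thesis
    using that k(1) by blast
qed

section \<open>Convexity from large balls outside the set\<close>

text \<open>
  As its radius grows, a ball that misses \<open>X\<close> and contains \<open>y\<close> behaves near \<open>y\<close> like a half-space,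
  which would separate \<open>y\<close> from \<open>X\<close> weakly only. To gain strictness, a point \<open>p\<close> outside \<open>X\<close> on a
  segment with end points in \<open>X\<close> is pushed slightly towards the ball around \<open>c\<close>. The resulting point \<open>y\<close>
  is still outside \<open>X\<close>, but it is a convex combination of points of \<open>X\<close> with weight \<open>t > 0\<close> on \<open>c\<close>, and
  there is room to replace \<open>c\<close> by the point \<open>c'\<close> that lies \<open>\<rho>\<close> further in the direction of the centre
  of the large ball. That makes the combination overshoot \<open>y\<close> in this direction by \<open>t * \<rho>\<close>, whatever the
  radius, whereas curvature accounts only for an overshoot that vanishes as the radius grows.
\<close>

lemma convex_if_complement_covered_by_large_balls:
  fixes X :: "'a::euclidean_space set"
  assumes "closed X" "cball c \<rho> \<subseteq> X" "\<rho> > 0"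
    and balls: "\<And>y K. y \<notin> X \<Longrightarrow> \<exists>m s. s > K \<and> y \<in> ball m s \<and> ball m s \<inter> X = {}"
  shows "convex X"
proof (rule convexI, rule ccontr)
  fix a b :: 'a and v w :: real
  assume ab: "a \<in> X" "b \<in> X" and vw: "0 \<le> v" "0 \<le> w" "v + w = 1"
  define p where "p = v *\<^sub>R a + w *\<^sub>R b"
  assume "v *\<^sub>R a + w *\<^sub>R b \<notin> X"
  then have "p \<in> - X" "open (- X)"
    using assms(1) by (auto simp: p_def)
  then obtain e where e: "e > 0" "ball p e \<subseteq> - X"
    by (meson openE)
  define h where "h = e / (norm (c - p) + 1)"
  define t where "t = min (1/2) (h / 2)"
  have n: "norm (c - p) + 1 > 0"
    by (smt (verit) norm_ge_zero)
  then have h: "h > 0" "h * (norm (c - p) + 1) = e"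
    using e(1) by (simp_all add: h_def)
  then have t: "0 < t" "t < 1" "t < h"
    by (auto simp: t_def min_def)
  have "t * norm (c - p) \<le> t * (norm (c - p) + 1)"
    using t(1) by simp
  also have "\<dots> < h * (norm (c - p) + 1)"
    using t(3) n by (rule mult_strict_right_mono)
  finally have te: "t * norm (c - p) < e"
    using h(2) by simp
  define y where "y = p + t *\<^sub>R (c - p)"
  have "y \<in> ball p e"
    using t(1) te by (simp add: y_def dist_norm)
  then have "y \<notin> X"
    using e by blast
  \<comment> \<open>A bound for the squared distances from \<open>y\<close> that does not depend on the large ball.\<close>
  define M where "M = (norm (a - y))\<^sup>2 + (norm (b - y))\<^sup>2 + (norm (c - y) + \<rho>)\<^sup>2"
  define \<kappa> where "\<kappa> = t * \<rho>"
  have \<kappa>: "\<kappa> > 0"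
    using t assms(3) by (simp add: \<kappa>_def)
  obtain m s where ms: "s > max (2 * \<kappa>) (M / (2 * \<kappa>) + M + 1)" "y \<in> ball m s" "ball m s \<inter> X = {}"
    using balls[OF \<open>y \<notin> X\<close>] by metis
  define d where "d = m - y"
  have "M \<ge> 0"
    by (simp add: M_def)
  have s: "s > 2 * \<kappa>" "s > M / (2 * \<kappa>)" "s > 0"
    using ms(1) \<kappa> \<open>M \<ge> 0\<close> by auto
  have ds: "norm d < s"
    using ms(2) by (simp add: d_def dist_norm)
  \<comment> \<open>Points of \<open>X\<close> lie outside the large ball, hence at most slightly on its centre's side of \<open>y\<close>.\<close>
  have key: "2 * ((z - y) \<bullet> d) \<le> (norm (z - y))\<^sup>2 + (norm d)\<^sup>2 - s\<^sup>2" if "z \<in> X" for z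
  proof -
    have "s \<le> norm ((z - y) - d)"
      using ms(3) that by (force simp: d_def dist_norm norm_minus_commute)
    then have "s\<^sup>2 \<le> (norm ((z - y) - d))\<^sup>2"
      using s by (intro power_mono) auto
    then show ?thesis
      by (simp add: power2_norm_eq_inner inner_simps inner_commute)
  qed
  define c' where "c' = c + \<rho> *\<^sub>R sgn d"
  have c': "c' \<in> X"
    using assms(2,3) by (auto simp: c'_def dist_norm norm_sgn subset_iff)
  have "norm (c' - y) \<le> norm (c - y) + \<rho>"
    using norm_triangle_ineq[of "c - y" "\<rho> *\<^sub>R sgn d"] assms(3)
    by (simp add: c'_def norm_sgn algebra_simps split: if_splits)
  then have "(norm (c' - y))\<^sup>2 \<le> (norm (c - y) + \<rho>)\<^sup>2"
    by (intro power_mono) auto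
  then have M: "(norm (z - y))\<^sup>2 \<le> M" if "z \<in> {a, b, c'}" for z
    using that by (auto simp: M_def intro: add_increasing add_increasing2)
  define Q where "Q = M + (norm d)\<^sup>2 - s\<^sup>2"
  have Q: "2 * ((z - y) \<bullet> d) \<le> Q" if "z \<in> {a, b, c'}" for z
    using key[of z] M[OF that] that ab c' by (auto simp: Q_def)
  have "((1 - t) * v) *\<^sub>R (a - y) + ((1 - t) * w) *\<^sub>R (b - y) + t *\<^sub>R (c' - y) = \<kappa> *\<^sub>R sgn d"
  proof -
    have "((1 - t) * v) *\<^sub>R (a - y) + ((1 - t) * w) *\<^sub>R (b - y) + t *\<^sub>R (c' - y)
        = (1 - t) *\<^sub>R p + t *\<^sub>R c' - ((1 - t) * (v + w) + t) *\<^sub>R y"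
      by (simp add: p_def algebra_simps)
    then show ?thesis
      by (simp add: vw y_def c'_def \<kappa>_def algebra_simps)
  qed
  then have "2 * ((\<kappa> *\<^sub>R sgn d) \<bullet> d) = 2 * ((((1 - t) * v) *\<^sub>R (a - y)
      + ((1 - t) * w) *\<^sub>R (b - y) + t *\<^sub>R (c' - y)) \<bullet> d)"
    by simp
  also have "\<dots> =
      (1 - t) * v * (2 * ((a - y) \<bullet> d)) + (1 - t) * w * (2 * ((b - y) \<bullet> d)) + t * (2 * ((c' - y) \<bullet> d))"
    unfolding inner_add_left inner_scaleR_left by (simp only: distrib_left mult.left_commute)
  also have "\<dots> \<le> (1 - t) * v * Q + (1 - t) * w * Q + t * Q"
    using t vw by (intro add_mono mult_left_mono Q) auto
  also have "\<dots> = ((1 - t) * (v + w) + t) * Q"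
    by (simp add: algebra_simps)
  also have "\<dots> = Q"
    by (simp add: vw)
  also have "(\<kappa> *\<^sub>R sgn d) \<bullet> d = \<kappa> * norm d"
    by (cases "d = 0") (simp_all add: sgn_div_norm dot_square_norm power2_eq_square)
  finally have "2 * (\<kappa> * norm d) \<le> M + (norm d)\<^sup>2 - s\<^sup>2"
    by (simp add: Q_def)
  \<comment> \<open>The radius exceeds \<open>2 * \<kappa>\<close>, so replacing \<open>norm d\<close> by \<open>s\<close> only weakens the inequality just
    obtained, and what remains is \<open>2 * \<kappa> * s \<le> M\<close>.\<close>
  moreover have "0 \<le> (s - norm d) * (s + norm d - 2 * \<kappa>)"
    using ds s norm_ge_zero[of d] by (intro mult_nonneg_nonneg) linarith+
  moreover have "M < 2 * \<kappa> * s"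
    using s(2) \<kappa> by (simp add: field_simps)
  ultimately show False
    by (simp add: algebra_simps power2_eq_square)
qed

section \<open>Iterating the erosion\<close>

locale self_similar_erosion =
  fixes X :: "'a::euclidean_space set" and r \<alpha> :: real and c :: 'a and U :: "'a \<Rightarrow> 'a"
  assumes r_pos: "0 < r" and nonempty: "X \<noteq> {}"
    and ratio_pos: "0 < \<alpha>" and ratio_less_1: "\<alpha> < 1"
    and orthogonal: "orthogonal_transformation U"
    and image_eq_erosion: "(\<lambda>x. c + \<alpha> *\<^sub>R U (x - c)) ` X = erosion r X"
begin

definition iterate :: "nat \<Rightarrow> 'a \<Rightarrow> 'a" where
  "iterate k x = c + \<alpha> ^ k *\<^sub>R (U ^^ k) (x - c)"

text \<open>
  The sum of the geometric series \<open>r + \<alpha> r + \<alpha>\<^sup>2 r + \<dots>\<close>, whose partial sums are the depths below.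
\<close>

definition limit_depth :: real where
  "limit_depth = r / (1 - \<alpha>)"

definition depth :: "nat \<Rightarrow> real" where
  "depth k = limit_depth * (1 - \<alpha> ^ k)"

lemmas orthogonal_power = orthogonal_transformation_funpow[OF orthogonal]

lemma limit_depth_gt: "limit_depth > r"
  using r_pos ratio_pos ratio_less_1 by (simp add: limit_depth_def field_simps)

lemma depth_nonneg: "depth k \<ge> 0"
  using limit_depth_gt r_pos ratio_pos ratio_less_1
  by (simp add: depth_def power_le_one)

lemma depth_pos: "k \<ge> 1 \<Longrightarrow> depth k > 0"
  using limit_depth_gt r_pos ratio_pos ratio_less_1
  by (simp add: depth_def power_less_one_iff)

lemma iterate_diff: "iterate k x - iterate k y = \<alpha> ^ k *\<^sub>R (U ^^ k) (x - y)"
proof -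
  have "(U ^^ k) (x - c) - (U ^^ k) (y - c) = (U ^^ k) (x - y)"
    using linear_diff[OF orthogonal_transformation_linear[OF orthogonal_power], of k "x - c" "y - c"]
    by simp
  then show ?thesis
    by (simp add: iterate_def flip: scaleR_diff_right)
qed

lemma dist_iterate: "dist (iterate k x) (iterate k y) = \<alpha> ^ k * dist x y"
  using ratio_pos by (simp add: dist_norm iterate_diff orthogonal_transformation_norm[OF orthogonal_power])

lemma similarity_iterate: "similarity (\<alpha> ^ k) (iterate k)"
  using ratio_pos by (simp add: similarity_def dist_iterate)

lemma inj_iterate: "inj (iterate k)"
proof (rule injI)
  fix x y assume "iterate k x = iterate k y"
  then have "\<alpha> ^ k * dist x y = 0"
    using dist_iterate[of k x y] by simp
  then show "x = y"
    using ratio_pos by simp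
qed

lemma surj_iterate: "surj (iterate k)"
proof (rule surjI)
  fix y
  have "(U ^^ k) (inv (U ^^ k) v) = v" for v
    using orthogonal_transformation_surj[OF orthogonal_power] by (rule surj_f_inv_f)
  then show "iterate k (c + inv (U ^^ k) ((1 / \<alpha> ^ k) *\<^sub>R (y - c))) = y"
    using ratio_pos by (simp add: iterate_def)
qed

text \<open>
  The \<open>k\<close>-th iterate maps the erosion of \<open>X\<close> by \<open>r\<close> to the erosion of the image of \<open>X\<close> by
  \<open>\<alpha> ^ k * r\<close>. So each further step erodes the previous image by the next term of the series.
\<close>

lemma iterate_image: "iterate k ` X = erosion (depth k) X"
proof (induction k)
  case 0
  then show ?case
    by (simp add: iterate_def depth_def)
next
  case (Suc k)
  have "iterate (Suc k) x = iterate k (c + \<alpha> *\<^sub>R U (x - c))" for x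
    by (simp add: iterate_def funpow_swap1 orthogonal_transformation_scaleR[OF orthogonal_power])
  then have "iterate (Suc k) ` X = iterate k ` erosion r X"
    by (simp add: image_image flip: image_eq_erosion)
  also have "\<dots> = erosion (\<alpha> ^ k * r) (iterate k ` X)"
    by (rule erosion_similarity_image[OF similarity_iterate surj_iterate, symmetric])
  also have "\<dots> = erosion (\<alpha> ^ k * r + depth k) X"
    using Suc r_pos ratio_pos depth_nonneg by (simp add: erosion_erosion)
  also have "\<alpha> ^ k * r + depth k = depth (Suc k)"
  proof -
    have "r = limit_depth * (1 - \<alpha>)"
      using ratio_less_1 by (simp add: limit_depth_def)
    then have "\<alpha> ^ k * r + depth k = \<alpha> ^ k * (limit_depth * (1 - \<alpha>)) + depth k"
      by simp
    then show ?thesis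
      by (simp add: depth_def algebra_simps)
  qed
  finally show ?case .
qed

lemma iterate_mem_erosion_iff: "iterate k x \<in> erosion (depth k) X \<longleftrightarrow> x \<in> X"
  using inj_iterate by (simp add: inj_image_mem_iff flip: iterate_image)

lemma ball_iterate_subset_iff: "k \<ge> 1 \<Longrightarrow> ball (iterate k x) (depth k) \<subseteq> X \<longleftrightarrow> x \<in> X"
  using mem_erosion_iff[OF depth_pos, of k "iterate k x" X] iterate_mem_erosion_iff[of k x] by simp

lemma continuous_on_iterate: "continuous_on S (iterate k)"
proof -
  have "continuous_on S (\<lambda>x. (U ^^ k) (x - c))"
    by (rule linear_continuous_on_compose)
      (intro continuous_intros orthogonal_transformation_linear[OF orthogonal_power])+
  then show ?thesis
    unfolding iterate_def by (intro continuous_intros)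
qed

lemma closed_X: "closed X"
proof -
  have "closed (iterate 1 -` erosion (depth 1) X)"
    by (intro closed_vimage continuous_on_iterate closed_erosion depth_pos) simp
  moreover have "iterate 1 -` erosion (depth 1) X = X"
    using iterate_mem_erosion_iff by blast
  ultimately show ?thesis
    by simp
qed

lemma cball_iterate_subset: "k \<ge> 1 \<Longrightarrow> x \<in> X \<Longrightarrow> cball (iterate k x) (depth k) \<subseteq> X"
  using ball_iterate_subset_iff depth_pos by (intro cball_subset_if_ball_subset closed_X) blast+

text \<open>
  The ball about \<open>c\<close> is a limit of balls in \<open>X\<close>: their centres run along the orbit of some point
  of \<open>X\<close> and their radii are the depths.
\<close>

lemma cball_limit_depth_subset: "cball c limit_depth \<subseteq> X"
proof -
  obtain x where x: "x \<in> X"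
    using nonempty by blast
  have pow: "(\<lambda>k. \<alpha> ^ k) \<longlonglongrightarrow> 0"
    using ratio_pos ratio_less_1 by (intro LIMSEQ_realpow_zero) auto
  have "iterate k c = c" for k
    by (simp add: iterate_def linear_0 orthogonal_transformation_linear[OF orthogonal_power])
  then have "dist (iterate k x) c = \<alpha> ^ k * dist x c" for k
    using dist_iterate[of k x c] by simp
  then have lim: "(\<lambda>k. iterate k x) \<longlonglongrightarrow> c"
    using tendsto_mult_right[OF pow, of "dist x c"] by (subst tendsto_dist_iff) simp
  have "y \<in> X" if "y \<in> ball c limit_depth" for y
  proof -
    have "(\<lambda>k. depth k - dist (iterate k x) y) \<longlonglongrightarrow> limit_depth * (1 - 0) - dist c y"
      unfolding depth_def by (intro tendsto_intros pow lim)
    moreover have "0 < limit_depth * (1 - 0) - dist c y"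
      using that by simp
    ultimately have "\<forall>\<^sub>F k in sequentially. 0 < depth k - dist (iterate k x) y"
      by (rule order_tendstoD)
    then obtain k where k: "k \<ge> 1" "0 < depth k - dist (iterate k x) y"
      unfolding eventually_sequentially by (meson linorder_le_cases order_refl)
    then have "y \<in> ball (iterate k x) (depth k)"
      by simp
    then show ?thesis
      using x k(1) ball_iterate_subset_iff by blast
  qed
  then have "ball c limit_depth \<subseteq> X"
    by blast
  then show ?thesis
    using limit_depth_gt r_pos by (intro cball_subset_if_ball_subset closed_X) auto
qed

text \<open>
  The image of \<open>y\<close> under the \<open>k\<close>-th iterate is not in the erosion, which gives a point \<open>q\<close> outside \<open>X\<close>
  within the depth of it. No iterate of a point of \<open>X\<close> is that close to \<open>q\<close>. The ball with centre \<open>q\<close>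
  pulled back by the iterate is therefore the one sought, with radius \<open>s = depth k / \<alpha> ^ k\<close>.
\<close>

lemma complement_covered_by_large_balls:
  assumes "y \<notin> X"
  shows "\<exists>m s. s > K \<and> y \<in> ball m s \<and> ball m s \<inter> X = {}"
proof -
  have L: "limit_depth > 0"
    using limit_depth_gt r_pos by simp
  define K' where "K' = max K 0"
  have "limit_depth / (K' + limit_depth) > 0"
    using L by (intro divide_pos_pos) (auto simp: K'_def)
  then obtain k where k: "\<alpha> ^ k < limit_depth / (K' + limit_depth)"
    using real_arch_pow_inv ratio_less_1 by blast
  have pow: "\<alpha> ^ k > 0"
    using ratio_pos by simp
  define s where "s = depth k / \<alpha> ^ k"
  have "\<alpha> ^ k * (K' + limit_depth) < limit_depth"
    using k L by (simp add: K'_def pos_less_divide_eq)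
  then have "K' * \<alpha> ^ k < depth k"
    by (simp add: depth_def algebra_simps)
  then have s: "s > K'"
    using pow by (simp add: s_def pos_less_divide_eq)
  have "k \<noteq> 0"
  proof
    assume "k = 0"
    then have "s = 0"
      by (simp add: s_def depth_def)
    then show False
      using s by (simp add: K'_def)
  qed
  then have k1: "k \<ge> 1"
    by simp
  have iff: "dist (iterate k a) (iterate k b) < depth k \<longleftrightarrow> dist a b < s" for a b
    using pow by (simp add: dist_iterate s_def pos_less_divide_eq mult.commute)
  obtain q where q: "q \<in> ball (iterate k y) (depth k)" "q \<notin> X"
    using assms ball_iterate_subset_iff[OF k1] by blast
  obtain m where m: "q = iterate k m"
    using surj_iterate by (rule surjE)
  have "y \<in> ball m s"
    using q(1) by (simp add: m iff dist_commute)
  moreover have "z \<notin> ball m s" if "z \<in> X" for z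
  proof
    assume "z \<in> ball m s"
    then have "q \<in> ball (iterate k z) (depth k)"
      by (simp add: m iff dist_commute)
    then show False
      using q(2) that ball_iterate_subset_iff[OF k1] by blast
  qed
  ultimately show ?thesis
    using s by (intro exI[of _ m] exI[of _ s]) (auto simp: K'_def)
qed

lemma convex_X: "convex X"
  using closed_X cball_limit_depth_subset _ complement_covered_by_large_balls
  by (rule convex_if_complement_covered_by_large_balls) (use limit_depth_gt r_pos in simp)

lemma interior_nonempty: "interior X \<noteq> {}"
proof -
  have "limit_depth > 0"
    using limit_depth_gt r_pos by simp
  then have "c \<in> interior X"
    using cball_limit_depth_subset by (rule centre_in_interior[rotated])
  then show ?thesis
    by blast
qed

text \<open>
  Otherwise the ball could be enlarged a little within \<open>X\<close>. All points near \<open>iterate k x\<close> would then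
  belong to the erosion, that is, to the image of \<open>X\<close>, and \<open>x\<close> would be an interior point.
\<close>

lemma cball_iterate_meets_frontier:
  assumes "k \<ge> 1" "x \<in> frontier X"
  shows "cball (iterate k x) (depth k) \<inter> frontier X \<noteq> {}"
proof
  define p where "p = iterate k x"
  define s where "s = depth k"
  assume "cball (iterate k x) (depth k) \<inter> frontier X = {}"
  moreover have "cball (iterate k x) (depth k) \<subseteq> X"
    using assms closed_X by (intro cball_iterate_subset) (auto simp: frontier_def)
  ultimately have "cball p s \<subseteq> interior X"
    using closure_subset unfolding p_def s_def frontier_def by blast
  moreover have s: "s > 0"
    using depth_pos assms(1) by (simp add: s_def)
  ultimately obtain \<epsilon> where \<epsilon>: "\<epsilon> > 0" "{z. infdist z (cball p s) \<le> \<epsilon>} \<subseteq> interior X"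
    using compact_in_open_separated[of "cball p s" "interior X"] by auto
  have "z \<in> X" if "z \<in> ball x (\<epsilon> / \<alpha> ^ k)" for z
  proof -
    have pz: "dist p (iterate k z) \<le> \<epsilon>"
      using that ratio_pos by (simp add: p_def dist_iterate pos_less_divide_eq mult.commute)
    have "w \<in> X" if "w \<in> ball (iterate k z) s" for w
    proof -
      have "w + (p - iterate k z) \<in> cball p s"
        using that by (simp add: dist_norm algebra_simps)
      moreover have "dist w (w + (p - iterate k z)) \<le> \<epsilon>"
        using pz by (simp add: dist_norm norm_minus_commute)
      ultimately have "infdist w (cball p s) \<le> \<epsilon>"
        by (rule infdist_le2)
      then show ?thesis
        using \<epsilon>(2) interior_subset by blast
    qed
    then have "ball (iterate k z) (depth k) \<subseteq> X"
      unfolding s_def by blast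
    then show ?thesis
      by (simp only: ball_iterate_subset_iff[OF assms(1)])
  qed
  then have "x \<in> interior X"
    using \<epsilon>(1) ratio_pos unfolding mem_interior by (intro exI[of _ "\<epsilon> / \<alpha> ^ k"]) auto
  then show False
    using assms(2) by (simp add: frontier_def)
qed

text \<open>
  Let the ball of radius \<open>depth k\<close> about \<open>iterate k x\<close> touch the boundary of \<open>X\<close> at \<open>y\<close>, with normal \<open>v\<close>.
  Eroding the supporting half-space at \<open>y\<close> moves its boundary to \<open>iterate k x\<close>, so \<open>v\<close> is a normal of
  the image of \<open>X\<close> there. Pulled back it is a normal of \<open>X\<close> at \<open>x\<close>, and \<open>u\<close> is the only one.
\<close>

lemma regular_normal_transported:
  assumes "regular_point X x" "outer_normal X x u" "k \<ge> 1" "w \<in> X"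
  shows "(U ^^ k) u \<bullet> w \<le> (U ^^ k) u \<bullet> iterate k x + depth k"
proof -
  define p where "p = iterate k x"
  have s: "depth k > 0"
    using depth_pos assms(3) by simp
  have pow: "\<alpha> ^ k > 0"
    using ratio_pos by simp
  have xf: "x \<in> frontier X"
    using assms(2) by (simp add: outer_normal_def)
  obtain y where y: "y \<in> frontier X" "dist p y \<le> depth k"
    using cball_iterate_meets_frontier[OF assms(3) xf] by (auto simp: p_def)
  obtain v where v: "outer_normal X y v"
    using ex_outer_normal[OF convex_X closed_X interior_nonempty y(1)] .
  have "v \<bullet> (y - p) \<le> depth k"
    using norm_cauchy_schwarz[of v "y - p"] v y(2)
    by (simp add: outer_normal_def dist_norm norm_minus_commute)
  then have vy: "v \<bullet> y \<le> v \<bullet> p + depth k"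
    by (simp add: inner_simps)
  obtain v' where v': "v = (U ^^ k) v'"
    using orthogonal_transformation_surj[OF orthogonal_power] by (rule surjE)
  have "v' \<bullet> z \<le> v' \<bullet> x" if "z \<in> X" for z
  proof -
    have "v \<bullet> iterate k z + depth k \<le> v \<bullet> y"
      using v s cball_iterate_subset[OF assms(3) that]
      by (intro cball_in_halfspace_bound[of v X]) (auto simp: outer_normal_def)
    then have "v \<bullet> (iterate k z - iterate k x) \<le> 0"
      using vy by (simp add: p_def inner_simps)
    then have "\<alpha> ^ k * (v' \<bullet> (z - x)) \<le> 0"
      using orthogonal_power[of k] by (simp add: iterate_diff v' orthogonal_transformation_def)
    then show ?thesis
      using pow by (simp add: mult_le_0_iff inner_simps)
  qed
  moreover have "norm v' = 1"
    using v by (simp add: v' outer_normal_def orthogonal_transformation_norm[OF orthogonal_power])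
  ultimately have "outer_normal X x v'"
    using xf by (simp add: outer_normal_def)
  then have "v' = u"
    using assms(1,2) by (auto simp: regular_point_iff_outer_normal)
  then show ?thesis
    using v vy assms(4) by (force simp: outer_normal_def v' p_def)
qed

text \<open>
  Suppose that the bound is exceeded by \<open>g > 0\<close>. In the direction \<open>(U ^^ k) u\<close> no point of \<open>X\<close>, in
  particular not \<open>x\<close>, exceeds it by more than \<open>\<alpha> ^ k * g\<close>. When \<open>(U ^^ k) u\<close> is close to \<open>u\<close>, this
  is impossible: the tolerance \<open>\<delta>\<close> below makes the two directions differ at \<open>x\<close> by less than the gap
  \<open>(1 - \<alpha>) * g\<close>.
\<close>

lemma regular_support_le:
  assumes "regular_point X x" "outer_normal X x u"
  shows "u \<bullet> x \<le> u \<bullet> c + limit_depth"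
proof (rule ccontr)
  assume exceeds: "\<not> ?thesis"
  define g where "g = u \<bullet> (x - c) - limit_depth"
  have g: "g > 0"
    using exceeds by (simp add: g_def inner_simps)
  define \<delta> where "\<delta> = (1 - \<alpha>) * g / (norm (x - c) + 1)"
  have n: "norm (x - c) + 1 > 0"
    by (smt (verit) norm_ge_zero)
  have \<delta>: "\<delta> > 0"
    using g n ratio_less_1 by (simp add: \<delta>_def)
  obtain k where k: "k \<ge> 1" "dist ((U ^^ k) u) u < \<delta>"
    using orthogonal_transformation_recurrent[OF orthogonal \<delta>] by blast
  have "x \<in> X"
    using assms(2) closed_X by (auto simp: outer_normal_def frontier_def)
  then have "(U ^^ k) u \<bullet> (x - c) \<le> (U ^^ k) u \<bullet> (iterate k x - c) + depth k"
    using regular_normal_transported[OF assms k(1), of x] by (simp add: inner_simps)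
  also have "(U ^^ k) u \<bullet> (iterate k x - c) = \<alpha> ^ k * (u \<bullet> (x - c))"
    using orthogonal_power[of k] by (simp add: iterate_def orthogonal_transformation_def)
  also have "\<alpha> ^ k * (u \<bullet> (x - c)) + depth k = limit_depth + \<alpha> ^ k * g"
    by (simp add: depth_def g_def algebra_simps)
  also have "\<dots> \<le> limit_depth + \<alpha> * g"
    using k(1) g ratio_pos ratio_less_1 power_decreasing[of 1 k \<alpha>] by simp
  finally have "(1 - \<alpha>) * g \<le> (u - (U ^^ k) u) \<bullet> (x - c)"
    by (simp add: g_def algebra_simps inner_diff_left)
  also have "\<dots> \<le> norm (u - (U ^^ k) u) * norm (x - c)"
    by (rule norm_cauchy_schwarz)
  also have "\<dots> \<le> \<delta> * norm (x - c)"
    using k(2) by (intro mult_right_mono) (auto simp: dist_norm norm_minus_commute)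
  also have "\<dots> < \<delta> * (norm (x - c) + 1)"
    using \<delta> by simp
  also have "\<dots> = (1 - \<alpha>) * g"
    using n by (simp add: \<delta>_def)
  finally show False
    by simp
qed

lemma inscribed_ball_limit_depth: "inscribed_ball X c limit_depth"
  unfolding inscribed_ball_iff_outer_normal
proof (intro conjI allI impI cball_limit_depth_subset)
  show L: "limit_depth > 0"
    using limit_depth_gt r_pos by simp
  fix x u assume x: "regular_point X x" "outer_normal X x u"
  have "u \<bullet> c + limit_depth \<le> u \<bullet> x"
    using x cball_limit_depth_subset L
    by (intro cball_in_halfspace_bound[of u X]) (auto simp: outer_normal_def)
  then show "u \<bullet> x = u \<bullet> c + limit_depth"
    using regular_support_le[OF x] by simp
qed

end

section \<open>Sets similar to their erosion\<close>

theorem theorem2p8: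
  fixes X :: "(real ^ 'n) set" and r :: real
  assumes "r > 0" and "X \<noteq> {}"
  shows "(\<exists>\<sigma> :: real ^ 'n \<Rightarrow> real ^ 'n.
            distance_decreasing_similarity \<sigma> \<and> \<sigma> ` X = erosion r X)
     \<longleftrightarrow> convex_body X \<and> (\<exists>c \<rho>. \<rho> > r \<and> inscribed_ball X c \<rho>)"
proof
  assume "\<exists>\<sigma> :: real ^ 'n \<Rightarrow> real ^ 'n. distance_decreasing_similarity \<sigma> \<and> \<sigma> ` X = erosion r X"
  then obtain \<sigma> :: "real ^ 'n \<Rightarrow> real ^ 'n" and \<alpha>
    where \<sigma>: "similarity \<alpha> \<sigma>" "\<alpha> < 1" "\<sigma> ` X = erosion r X"
    by (auto simp: distance_decreasing_similarity_def)
  then obtain c U where U: "orthogonal_transformation U" "\<sigma> = (\<lambda>x. c + \<alpha> *\<^sub>R U (x - c))"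
    using contracting_similarity_decompose by blast
  interpret self_similar_erosion X r \<alpha> c U
    using assms \<sigma> U by unfold_locales (auto simp: similarity_def)
  show "convex_body X \<and> (\<exists>c \<rho>. \<rho> > r \<and> inscribed_ball X c \<rho>)"
    using closed_X convex_X limit_depth_gt inscribed_ball_limit_depth
    by (auto simp: convex_body_def)
next
  assume "convex_body X \<and> (\<exists>c \<rho>. \<rho> > r \<and> inscribed_ball X c \<rho>)"
  then obtain c \<rho> where X: "convex_body X" "inscribed_ball X c \<rho>" and \<rho>: "r < \<rho>"
    by blast
  define \<sigma> where "\<sigma> x = c + (1 - r / \<rho>) *\<^sub>R (x - c)" for x
  have \<alpha>: "0 < 1 - r / \<rho>" "1 - r / \<rho> < 1"
    using \<rho> assms(1) by auto
  have "dist (\<sigma> x) (\<sigma> y) = (1 - r / \<rho>) * dist x y" for x y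
    using \<alpha>(1) by (simp add: \<sigma>_def dist_norm flip: scaleR_diff_right)
  then have "distance_decreasing_similarity \<sigma>"
    using \<alpha> unfolding distance_decreasing_similarity_def similarity_def by blast
  moreover have "\<sigma> ` X = erosion r X"
    using erosion_eq_homothety_if_inscribed_ball[OF X assms(1) \<rho>] by (simp add: \<sigma>_def[abs_def])
  ultimately show "\<exists>\<sigma> :: real ^ 'n \<Rightarrow> real ^ 'n.
      distance_decreasing_similarity \<sigma> \<and> \<sigma> ` X = erosion r X"
    by blast
qed

end
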